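(* Let $k$ and $n$ be positive integers. The number $\widetilde{b}_k(n)$ of minimal bridges from $(0,0)$ to $(kn,n)$ is $$\widetilde{b}_k(n)=\frac{k}{kn+n-1}\binom{kn+n}{n}.$$
   Context: A bridge of size $n$ (with respect to the line $y=x/k$) is a lattice path from $(0,0)$ to $(kn,n)$ composed only of unit steps to the right $(1,0)$ and up $(0,1)$. A minimal bridge is a nontrivial bridge that contains no lattice points on the line $y=x/k$ other than its two endpoints. *)

theory Defs
  imports Complex_Main
begin

type_synonym lattice_point = "int \<times> int"

datatype step = East | North

fun move :: "step \<Rightarrow> lattice_point \<Rightarrow> lattice_point" where
  "move East (x, y) = (x + 1, y)"
| "move North (x, y) = (x, y + 1)"

text \<open>
  A path is given by its starting point and its list of steps. Since every step has
  unit length, the lattice points contained in the path are exactly the listed ones.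
\<close>

fun path_points :: "lattice_point \<Rightarrow> step list \<Rightarrow> lattice_point list" where
  "path_points p [] = [p]"
| "path_points p (s # w) = p # path_points (move s p) w"

definition on_line :: "nat \<Rightarrow> lattice_point \<Rightarrow> bool" where
  "on_line k p \<longleftrightarrow> real_of_int (snd p) = real_of_int (fst p) / real k"

definition bridge :: "nat \<Rightarrow> nat \<Rightarrow> step list \<Rightarrow> bool" where
  "bridge k n w \<longleftrightarrow> last (path_points (0, 0) w) = (int (k * n), int n)"

text \<open>
  A path that crosses the line between two lattice points is not excluded.
\<close>

definition minimal_bridge :: "nat \<Rightarrow> nat \<Rightarrow> step list \<Rightarrow> bool" where
  "minimal_bridge k n w \<longleftrightarrow> bridge k n w \<and> w \<noteq> [] \<and>
     (\<forall>p \<in> set (path_points (0, 0) w).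
        on_line k p \<longrightarrow> p = (0, 0) \<or> p = (int (k * n), int n))"

definition num_minimal_bridges :: "nat \<Rightarrow> nat \<Rightarrow> nat" where
  "num_minimal_bridges k n = card {w. minimal_bridge k n w}"

end

theory Submission
  imports Defs
begin

text \<open>
  Let a step East change the height by \<open>1\<close> and a step North by \<open>- k\<close>. A minimal bridge
  is positive up to some North step, and negative from there to its end, since it can only return
  from negative heights through \<open>0\<close>. Hence it is \<open>u @ North # rev v\<close> where both
  \<open>u\<close> and \<open>v\<close> are positive walks and their final heights add up to \<open>k\<close>.
  Such pairs correspond to pairs of a positive walk \<open>u @ v\<close> of final height \<open>k\<close>
  and a height \<open>j \<in> {0..k}\<close>, as cutting at the last visit to \<open>j\<close> recovers
  \<open>u\<close> and \<open>v\<close>. Therefore there are \<open>k + 1\<close> times as many minimal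
  bridges as positive walks with \<open>k * n\<close> steps East and \<open>n - 1\<close> steps North, and
  the latter are counted by the ballot theorem.
\<close>

section \<open>Heights and positive walks\<close>

definition height :: "nat \<Rightarrow> step list \<Rightarrow> int" where
  "height k w = int (count_list w East) - int k * int (count_list w North)"

text \<open>The empty walk is included. It is needed as \<open>u\<close> for bridges that begin with
  \<open>North\<close>, and as \<open>v\<close> for bridges that stay positive until their last
  step.\<close>

definition positive :: "nat \<Rightarrow> step list \<Rightarrow> bool" where
  "positive k w \<longleftrightarrow> (\<forall>x y. w = x @ y \<longrightarrow> x \<noteq> [] \<longrightarrow> 0 < height k x)"

definition ballot_walks :: "nat \<Rightarrow> nat \<Rightarrow> nat \<Rightarrow> step list set" where
  "ballot_walks k a b =
     {w. positive k w \<and> count_list w East = a \<and> count_list w North = b}"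

lemma height_simps [simp]:
  "height k [] = 0"
  "height k (East # w) = 1 + height k w"
  "height k (North # w) = height k w - int k"
  "height k (u @ v) = height k u + height k v"
  "height k (rev w) = height k w"
  by (simp_all add: height_def algebra_simps)

lemma length_count_step: "length w = count_list w East + count_list w North"
proof (induction w)
  case (Cons s w)
  then show ?case by (cases s) auto
qed simp

lemma positive_Nil [simp]: "positive k []"
  by (simp add: positive_def)

lemma positive_snoc: "positive k (w @ [s]) \<longleftrightarrow> positive k w \<and> 0 < height k (w @ [s])"
proof
  assume *: "positive k (w @ [s])"
  have "positive k w"
    unfolding positive_def using * by (auto simp: positive_def simp del: height_simps)
  with * show "positive k w \<and> 0 < height k (w @ [s])"
    unfolding positive_def by blast
next
  assume *: "positive k w \<and> 0 < height k (w @ [s])"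
  show "positive k (w @ [s])"
    unfolding positive_def
  proof (intro allI impI)
    fix x y
    assume xy: "w @ [s] = x @ y" and x: "x \<noteq> []"
    show "0 < height k x"
    proof (cases y rule: rev_cases)
      case Nil
      with xy * show ?thesis by simp
    next
      case (snoc y' t)
      with xy have "w = x @ y'" by simp
      with * x show ?thesis by (simp add: positive_def)
    qed
  qed
qed

lemma positive_prefix: "positive k (u @ v) \<Longrightarrow> positive k u"
  by (simp add: positive_def)

lemma positive_height_nonneg: "positive k w \<Longrightarrow> 0 \<le> height k w"
  by (cases "w = []") (force simp: positive_def)+

text \<open>Past the end of \<open>u\<close>, the height is that of \<open>u\<close>, which is
  nonnegative, plus that of a nonempty prefix of \<open>v\<close>, which is positive.\<close>

lemma positive_append: "positive k u \<Longrightarrow> positive k v \<Longrightarrow> positive k (u @ v)"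
proof (induction v rule: rev_induct)
  case (snoc s v)
  then have "0 < height k (v @ [s])" by (simp add: positive_snoc)
  with snoc show ?case
    using positive_snoc[of k v s] positive_snoc[of k "u @ v" s]
      positive_height_nonneg[of k u] by simp
qed simp

section \<open>The ballot theorem\<close>

lemma finite_ballot_walks: "finite (ballot_walks k a b)"
proof (rule finite_subset)
  show "ballot_walks k a b \<subseteq> {w. set w \<subseteq> {East, North} \<and> length w = a + b}"
    using step.exhaust by (auto simp: ballot_walks_def length_count_step)
  show "finite {w. set w \<subseteq> {East, North} \<and> length w = a + b}"
    by (rule finite_lists_length_eq) simp
qed

lemma ballot_walks_0_0: "ballot_walks k 0 0 = {[]}"
proof -
  have "w = []" if "count_list w East = 0" "count_list w North = 0" for w
    using length_count_step[of w] that by simp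
  then show ?thesis by (auto simp: ballot_walks_def)
qed

lemma ballot_walks_eq_empty:
  assumes "a = k * b" "0 < a + b"
  shows "ballot_walks k a b = {}"
proof -
  have False if "positive k w" "count_list w East = a" "count_list w North = b" for w
  proof -
    from that assms have "w \<noteq> []" by auto
    with that(1) have "0 < height k w" by (simp add: positive_def)
    with that assms show False by (simp add: height_def)
  qed
  then show ?thesis by (auto simp: ballot_walks_def)
qed

text \<open>Classify by the last step. As \<open>k * b < a\<close>, the final height is positive
  anyway, so either kind of step may be appended to a positive walk with the right step
  counts.\<close>

lemma card_ballot_walks_rec:
  assumes "k * b < a"
  shows "card (ballot_walks k a b) = card (ballot_walks k (a - 1) b) +
     (if b = 0 then 0 else card (ballot_walks k a (b - 1)))"
proof -
  let ?E = "(\<lambda>w. w @ [East]) ` ballot_walks k (a - 1) b"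
  let ?N = "if b = 0 then {} else (\<lambda>w. w @ [North]) ` ballot_walks k a (b - 1)"
  have a: "int k * int b < int a"
    using assms by (metis of_nat_less_iff of_nat_mult)
  have "w \<in> ballot_walks k a b \<longleftrightarrow> w \<in> ?E \<union> ?N" for w
  proof (cases w rule: rev_cases)
    case Nil
    with assms show ?thesis by (auto simp: ballot_walks_def)
  next
    case (snoc v s)
    have pos: "0 < height k w" if "count_list w East = a" "count_list w North = b"
      using that a by (simp add: height_def)
    show ?thesis
    proof (cases s)
      case East
      then show ?thesis using snoc assms pos
        by (auto simp: ballot_walks_def positive_snoc image_iff simp del: height_simps)
    next
      case North
      then show ?thesis using snoc assms pos
        by (auto simp: ballot_walks_def positive_snoc image_iff simp del: height_simps)
    qed
  qed
  then have "ballot_walks k a b = ?E \<union> ?N" by blast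
  moreover have "card (?E \<union> ?N) = card ?E + card ?N"
    by (rule card_Un_disjoint) (auto simp: finite_ballot_walks)
  ultimately show ?thesis
    by (simp add: card_image inj_on_def)
qed

text \<open>Induction on the length by removing the last step. The boundary
  \<open>a = k * b\<close>, where both sides vanish, is included because the recurrence can lead to
  it. Multiplying out over the reals avoids truncated subtraction.\<close>

theorem ballot:
  assumes "k * b \<le> a" "0 < a + b"
  shows "real (a + b) * real (card (ballot_walks k a b)) =
    (real a - real k * real b) * real ((a + b) choose b)"
  using assms
proof (induction "a + b" arbitrary: a b rule: less_induct)
  case less
  show ?case
  proof (cases "a = k * b")
    case True
    then show ?thesis using ballot_walks_eq_empty[OF True less.prems(2)] by simp
  next
    case False
    with less.prems have lt: "k * b < a" by simp
    then obtain a' where a: "a = Suc a'" by (cases a) auto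
    show ?thesis
    proof (cases b)
      case 0
      show ?thesis
      \<comment> \<open>The induction hypothesis excludes the empty walk, so a walk of length 1 is
        treated directly.\<close>
      proof (cases "a' = 0")
        case True
        then show ?thesis
          using card_ballot_walks_rec[OF lt] by (simp add: a 0 ballot_walks_0_0)
      next
        case False
        then show ?thesis
          using card_ballot_walks_rec[OF lt] less.hyps[of a' b] by (simp add: a 0)
      qed
    next
      case (Suc b')
      have le: "k * b \<le> a'" "k * b' \<le> a" using lt by (simp_all add: a Suc)
      \<comment> \<open>This is \<open>a + b - 1\<close>, the common length of both kinds of
        shortened walks.\<close>
      let ?m = "real a' + real b' + 1"
      let ?C = "real ((a + b) choose b)"
      have E: "?m * card (ballot_walks k a' b) = (real a' - real k * real b) * real ((a' + b) choose b)"
        using less.hyps[of a' b] le by (simp add: a Suc algebra_simps)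
      have N: "?m * card (ballot_walks k a b') = (real a - real k * real b') * real ((a' + b) choose b')"
        using less.hyps[of a b'] le by (simp add: a Suc algebra_simps)
      \<comment> \<open>Absorption and Pascal's rule express both smaller binomials through
        \<open>?C\<close>, with the factors \<open>b / (a + b)\<close> and
        \<open>a / (a + b)\<close>.\<close>
      have "Suc b' * (Suc (a' + b) choose Suc b') = Suc (a' + b) * ((a' + b) choose b')"
        by (rule Suc_times_binomial)
      then have "real (Suc b' * (Suc (a' + b) choose Suc b')) = real (Suc (a' + b) * ((a' + b) choose b'))"
        by (simp only:)
      then have C1: "real (a + b) * real ((a' + b) choose b') = real b * ?C"
        by (simp add: a Suc algebra_simps)
      have "?C = real ((a' + b) choose b) + real ((a' + b) choose b')"
        by (simp add: a Suc)
      then have "real (a + b) * real ((a' + b) choose b) =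
          real (a + b) * ?C - real (a + b) * real ((a' + b) choose b')"
        by (simp add: algebra_simps)
      with C1 have C2: "real (a + b) * real ((a' + b) choose b) = real a * ?C"
        by (simp add: algebra_simps)
      have "?m * (real (a + b) * real (card (ballot_walks k a b))) =
         real (a + b) * (?m * card (ballot_walks k a' b) + ?m * card (ballot_walks k a b'))"
        using card_ballot_walks_rec[OF lt] by (simp add: a Suc algebra_simps)
      also have "\<dots> = (real a' - real k * real b) * (real (a + b) * real ((a' + b) choose b)) +
         (real a - real k * real b') * (real (a + b) * real ((a' + b) choose b'))"
        unfolding E N by (simp only: algebra_simps)
      also have "\<dots> = ((real a' - real k * real b) * real a + (real a - real k * real b') * real b) * ?C"
        unfolding C1 C2 by (simp only: algebra_simps)
      \<comment> \<open>With \<open>a' = a - 1\<close> and \<open>b' = b - 1\<close>, the left side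
        is \<open>(a + b) * (a - k * b) - (a - k * b)\<close>.\<close>
      also have "(real a' - real k * real b) * real a + (real a - real k * real b') * real b =
          ?m * (real a - real k * real b)"
        by (simp add: a Suc algebra_simps)
      finally have "?m * (real (a + b) * real (card (ballot_walks k a b))) =
          ?m * ((real a - real k * real b) * ?C)"
        by (simp only: mult.assoc)
      moreover have "?m \<noteq> 0" by linarith
      ultimately show ?thesis using mult_cancel_left by blast
    qed
  qed
qed

section \<open>Cutting walks at a height and at sign changes\<close>

text \<open>A step raises the height by at most 1, so a walk from 0 to a height of at least
  \<open>j\<close> visits \<open>j\<close>. After its last visit it stays above \<open>j\<close>,
  which makes the remainder positive.\<close>

lemma positive_split_at_height:
  assumes "positive k w" "0 \<le> j" "j \<le> height k w"
  obtains u v where "w = u @ v" "height k u = j" "positive k v"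
proof -
  have "\<exists>u v. w = u @ v \<and> height k u = j \<and> positive k v"
    using assms
  proof (induction w rule: rev_induct)
    case (snoc s w)
    show ?case
    proof (cases "j = height k (w @ [s])")
      case True
      then show ?thesis by (metis append_Nil2 positive_Nil)
    next
      case False
      with snoc.prems have j: "j < height k (w @ [s])" by simp
      then have "j \<le> height k w" by (cases s) auto
      with snoc obtain u v where uv: "w = u @ v" "height k u = j" "positive k v"
        by (auto simp: positive_snoc)
      with j have "positive k (v @ [s])" by (simp add: positive_snoc)
      with uv show ?thesis by (metis append.assoc)
    qed
  qed simp
  with that show thesis by blast
qed

text \<open>Take the shortest nonempty prefix of height at most 0. What precedes its last step has
  nonnegative height, from where a step \<open>East\<close> leads to a positive height.\<close>

lemma not_positive_first_drop:
  assumes "\<not> positive k w"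
  obtains u y where "w = u @ North # y" "positive k u" "height k (u @ [North]) \<le> 0"
proof -
  have "\<exists>u y. w = u @ North # y \<and> positive k u \<and> height k (u @ [North]) \<le> 0"
    using assms
  proof (induction w rule: rev_induct)
    case (snoc s w)
    show ?case
    proof (cases "positive k w")
      case True
      with snoc.prems positive_height_nonneg[OF True]
      have "s = North" "height k (w @ [North]) \<le> 0"
        by (cases s; simp add: positive_snoc)+
      with True show ?thesis by blast
    next
      case False
      with snoc.IH obtain u y
        where "w = u @ North # y" "positive k u" "height k (u @ [North]) \<le> 0" by blast
      then show ?thesis by (intro exI[of _ u] exI[of _ "y @ [s]"]) simp
    qed
  qed simp
  with that show thesis by blast
qed

text \<open>Only \<open>East\<close> raises the height, and only by 1, so negative heights can be
  left only through 0.\<close>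

lemma height_stays_negative:
  assumes "height k p < 0" "\<And>x y. z = x @ y \<Longrightarrow> height k (p @ x) \<noteq> 0"
  shows "height k (p @ z) < 0"
  using assms(2)
proof (induction z rule: rev_induct)
  case Nil
  then show ?case using assms(1) by simp
next
  case (snoc s z)
  have "height k (p @ z) < 0"
    by (rule snoc.IH) (use snoc.prems in \<open>metis append.assoc\<close>)
  moreover have "height k (p @ z @ [s]) \<noteq> 0"
    using snoc.prems[of "z @ [s]" "[]"] by simp
  ultimately show ?case by (cases s) auto
qed

section \<open>Minimal bridges in terms of heights\<close>

lemma set_path_points:
  "set (path_points (a, b) w) =
     {(a + int (count_list x East), b + int (count_list x North)) | x y. w = x @ y}"
proof (induction w arbitrary: a b)
  case (Cons s w)
  have "{f x | x y. s # w = x @ y} = insert (f []) {f (s # x) | x y. w = x @ y}"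
    for f :: "step list \<Rightarrow> lattice_point"
    by (auto simp: Cons_eq_append_conv)
  then show ?case
    by (cases s) (simp_all add: Cons.IH algebra_simps)
qed simp

lemma last_path_points:
  "last (path_points (a, b) w) =
     (a + int (count_list w East), b + int (count_list w North))"
proof (induction w arbitrary: a b)
  case (Cons s w)
  have "path_points p w \<noteq> []" for p by (cases w) auto
  then show ?case by (cases s) (simp_all add: Cons.IH)
qed simp

lemma minimal_bridge_iff_height:
  assumes "0 < k" "0 < n"
  shows "minimal_bridge k n w \<longleftrightarrow>
    count_list w East = k * n \<and> count_list w North = n \<and>
    (\<forall>x y. w = x @ y \<longrightarrow> x \<noteq> [] \<longrightarrow> y \<noteq> [] \<longrightarrow> height k x \<noteq> 0)"
proof -
  have line: "on_line k (int (count_list x East), int (count_list x North)) \<longleftrightarrow> height k x = 0"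
    for x
  proof -
    have "on_line k (int (count_list x East), int (count_list x North)) \<longleftrightarrow>
        real (count_list x North) * real k = real (count_list x East)"
      using assms by (simp add: on_line_def field_simps)
    also have "\<dots> \<longleftrightarrow> count_list x North * k = count_list x East"
      by (metis of_nat_eq_iff of_nat_mult)
    also have "\<dots> \<longleftrightarrow> int (count_list x North) * int k = int (count_list x East)"
      by (metis of_nat_eq_iff of_nat_mult)
    finally show ?thesis by (auto simp: height_def algebra_simps)
  qed
  \<comment> \<open>The coordinates of a prefix determine its length, so only the empty prefix ends
    at the origin and only the whole path at the far endpoint.\<close>
  have start: "count_list x East = 0 \<and> count_list x North = 0 \<longleftrightarrow> x = []" for x
    using length_count_step[of x] by auto
  have fin: "count_list x East = count_list (x @ y) East \<and>
      count_list x North = count_list (x @ y) North \<longleftrightarrow> y = []" for x y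
    using length_count_step[of y] by auto
  have bridge: "bridge k n w \<longleftrightarrow> count_list w East = k * n \<and> count_list w North = n"
    by (auto simp: bridge_def last_path_points simp flip: of_nat_mult)
  have "(\<forall>p \<in> set (path_points (0, 0) w).
          on_line k p \<longrightarrow> p = (0, 0) \<or> p = (int (k * n), int n)) \<longleftrightarrow>
        (\<forall>x y. w = x @ y \<longrightarrow> x \<noteq> [] \<longrightarrow> y \<noteq> [] \<longrightarrow> height k x \<noteq> 0)"
    if w: "count_list w East = k * n" "count_list w North = n"
  proof -
    have ball: "(\<forall>p \<in> {f x | x y. w = x @ y}. P p) \<longleftrightarrow> (\<forall>x y. w = x @ y \<longrightarrow> P (f x))"
      for f :: "step list \<Rightarrow> lattice_point" and P
      by blast
    have "(\<forall>p \<in> set (path_points (0, 0) w).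
          on_line k p \<longrightarrow> p = (0, 0) \<or> p = (int (k * n), int n)) \<longleftrightarrow>
        (\<forall>x y. w = x @ y \<longrightarrow> height k x = 0 \<longrightarrow>
          count_list x East = 0 \<and> count_list x North = 0 \<or>
          count_list x East = k * n \<and> count_list x North = n)"
      unfolding set_path_points ball by (simp add: line del: of_nat_mult)
    also have "\<dots> \<longleftrightarrow> (\<forall>x y. w = x @ y \<longrightarrow> height k x = 0 \<longrightarrow> x = [] \<or> y = [])"
      using start fin w by metis
    finally show ?thesis by blast
  qed
  moreover have "w \<noteq> []" if "count_list w North = n"
    using that assms by auto
  ultimately show ?thesis
    unfolding minimal_bridge_def bridge by blast
qed

section \<open>Two bijections from pairs of positive walks\<close>

definition ballot_pairs :: "nat \<Rightarrow> nat \<Rightarrow> (step list \<times> step list) set" where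
  "ballot_pairs k n = {(u, v). positive k u \<and> positive k v \<and>
     count_list u East + count_list v East = k * n \<and>
     Suc (count_list u North + count_list v North) = n}"

text \<open>The \<open>Suc\<close> in \<open>ballot_pairs\<close> accounts for the
  \<open>North\<close> step placed between the two walks of a bridge. Together they have height
  \<open>k * n - k * (n - 1)\<close>.\<close>

lemma ballot_pairs_height:
  assumes "(u, v) \<in> ballot_pairs k n"
  shows "height k u + height k v = int k"
proof -
  from assms have "int (count_list u East) + int (count_list v East) =
      int k * int (Suc (count_list u North + count_list v North))"
    by (auto simp: ballot_pairs_def simp flip: of_nat_add of_nat_mult)
  then show ?thesis by (simp add: height_def algebra_simps)
qed

lemma bij_betw_minimal_bridges:
  assumes "0 < k" "0 < n"
  shows "bij_betw (\<lambda>(u, v). u @ North # rev v) (ballot_pairs k n) {w. minimal_bridge k n w}"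
  unfolding bij_betw_def
proof
  \<comment> \<open>The \<open>North\<close> step after \<open>u\<close> leads to height
    \<open>- height k v\<close>, which is at most 0, so it cannot occur inside a positive walk that
    continues \<open>u\<close>. This makes the decomposition unique.\<close>
  have aux: False
    if "(u, v) \<in> ballot_pairs k n" "(u @ North # x, v') \<in> ballot_pairs k n" for u v x v'
  proof -
    from that(2) have "positive k ((u @ [North]) @ x)" by (simp add: ballot_pairs_def)
    then have "0 < height k (u @ [North])"
      unfolding positive_def by blast
    moreover have "0 \<le> height k v"
      using that by (auto simp: ballot_pairs_def positive_height_nonneg)
    ultimately show False using ballot_pairs_height[OF that(1)] by simp
  qed
  show "inj_on (\<lambda>(u, v). u @ North # rev v) (ballot_pairs k n)"
  proof (rule inj_onI, clarify)
    fix u v u' v'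
    assume *: "(u, v) \<in> ballot_pairs k n" "(u', v') \<in> ballot_pairs k n"
      and eq: "u @ North # rev v = u' @ North # rev v'"
    from eq consider "u = u'" "v = v'" | x where "u' = u @ North # x" | x where "u = u' @ North # x"
      by (auto simp: append_eq_append_conv2 append_eq_Cons_conv Cons_eq_append_conv)
    then show "u = u' \<and> v = v'"
      using * aux by cases blast+
  qed
  have "minimal_bridge k n (u @ North # rev v)" if uv: "(u, v) \<in> ballot_pairs k n" for u v
    unfolding minimal_bridge_iff_height[OF assms]
  proof (intro conjI allI impI)
    show "count_list (u @ North # rev v) East = k * n"
      "count_list (u @ North # rev v) North = n"
      using uv by (auto simp: ballot_pairs_def)
    fix x y
    assume xy: "u @ North # rev v = x @ y" "x \<noteq> []" "y \<noteq> []"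
    then consider z where "u = x @ z" | z where "rev v = z @ y" "x = u @ North # z"
      by (auto simp: append_eq_append_conv2 Cons_eq_append_conv)
    then show "height k x \<noteq> 0"
    proof cases
      case 1
      with uv xy(2) show ?thesis by (fastforce simp: ballot_pairs_def positive_def)
    next
      case 2
      \<comment> \<open>The total height is 0, so \<open>x\<close> has minus the height of
        \<open>rev y\<close>, a nonempty prefix of \<open>v\<close>.\<close>
      then have v: "v = rev y @ rev z" by (metis rev_append rev_rev_ident)
      with uv have "positive k (rev y @ rev z)" by (simp add: ballot_pairs_def)
      with xy(3) have "0 < height k (rev y)" unfolding positive_def by blast
      with ballot_pairs_height[OF uv] show ?thesis by (simp add: 2 v)
    qed
  qed
  moreover have "w \<in> (\<lambda>(u, v). u @ North # rev v) ` ballot_pairs k n"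
    if "minimal_bridge k n w" for w
  proof -
    from that have w: "count_list w East = k * n" "count_list w North = n"
      and nz: "\<And>x y. w = x @ y \<Longrightarrow> x \<noteq> [] \<Longrightarrow> y \<noteq> [] \<Longrightarrow> height k x \<noteq> 0"
      by (auto simp: minimal_bridge_iff_height[OF assms])
    have hw: "height k w = 0" by (simp add: height_def w)
    have "w \<noteq> []" using w assms by auto
    then have "\<not> positive k w"
      using hw unfolding positive_def by (metis append_Nil2 less_irrefl)
    then obtain u y where uy: "w = u @ North # y" "positive k u" "height k (u @ [North]) \<le> 0"
      by (rule not_positive_first_drop)
    have "positive k (rev y)"
      unfolding positive_def
    proof (intro allI impI)
      fix x z
      assume yz: "rev y = x @ z" and x: "x \<noteq> []"
      from yz have y: "y = rev z @ rev x" by (metis rev_append rev_rev_ident)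
      \<comment> \<open>The nonempty \<open>rev x\<close> still follows, so these prefixes end in
        the interior of the bridge. Hence the heights stay negative after the drop, and
        \<open>x\<close> must make up for the negative height before it.\<close>
      have ne: "height k ((u @ [North]) @ r) \<noteq> 0" if "rev z = r @ s" for r s
        by (rule nz[of _ "s @ rev x"]) (use uy y that x in auto)
      have "height k (u @ [North]) < 0"
        using ne[of "[]"] uy(3) by simp
      then have "height k ((u @ [North]) @ rev z) < 0"
        by (rule height_stays_negative) (use ne in blast)
      with hw show "0 < height k x" by (simp add: uy(1) y)
    qed
    with uy w have "(u, rev y) \<in> ballot_pairs k n"
      by (auto simp: ballot_pairs_def)
    then show ?thesis using uy(1) by force
  qed
  ultimately show "(\<lambda>(u, v). u @ North # rev v) ` ballot_pairs k n = {w. minimal_bridge k n w}"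
    by auto
qed

lemma bij_betw_ballot_walks:
  assumes "0 < n"
  shows "bij_betw (\<lambda>(u, v). (u @ v, height k u)) (ballot_pairs k n)
    (ballot_walks k (k * n) (n - 1) \<times> {0..int k})"
  unfolding bij_betw_def
proof
  \<comment> \<open>Two cuts at the same height enclose a piece of height 0, which as a prefix of a
    positive walk is empty.\<close>
  have aux: "x = []" if "positive k (x @ z)" "height k (u @ x) = height k u" for u x z
    using that by (fastforce simp: positive_def)
  show "inj_on (\<lambda>(u, v). (u @ v, height k u)) (ballot_pairs k n)"
  proof (rule inj_onI, clarify)
    fix u v u' v'
    assume *: "(u, v) \<in> ballot_pairs k n" "(u', v') \<in> ballot_pairs k n"
      and eq: "u @ v = u' @ v'" "height k u = height k u'"
    from eq(1) consider x where "u = u' @ x" "v' = x @ v" | x where "u' = u @ x" "v = x @ v'"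
      by (auto simp: append_eq_append_conv2)
    then show "u = u' \<and> v = v'"
    proof cases
      case 1
      have "positive k (x @ v)" using *(2) by (simp add: ballot_pairs_def 1)
      moreover have "height k (u' @ x) = height k u'" using eq(2) by (simp only: 1)
      ultimately have "x = []" by (rule aux)
      with 1 show ?thesis by simp
    next
      case 2
      have "positive k (x @ v')" using *(1) by (simp add: ballot_pairs_def 2)
      moreover have "height k (u @ x) = height k u" using eq(2) by (simp only: 2)
      ultimately have "x = []" by (rule aux)
      with 2 show ?thesis by simp
    qed
  qed
  have "(u @ v, height k u) \<in> ballot_walks k (k * n) (n - 1) \<times> {0..int k}"
    if uv: "(u, v) \<in> ballot_pairs k n" for u v
  proof -
    from uv have "0 \<le> height k u" "0 \<le> height k v"
      by (auto simp: ballot_pairs_def positive_height_nonneg)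
    with ballot_pairs_height[OF uv] uv show ?thesis
      by (auto simp: ballot_walks_def ballot_pairs_def positive_append)
  qed
  moreover have "(w, j) \<in> (\<lambda>(u, v). (u @ v, height k u)) ` ballot_pairs k n"
    if w: "w \<in> ballot_walks k (k * n) (n - 1)" and j: "0 \<le> j" "j \<le> int k" for w j
  proof -
    \<comment> \<open>This is \<open>k * n - k * (n - 1)\<close>. It brings every \<open>j\<close>
      from 0 to \<open>k\<close> within reach of the splitting lemma.\<close>
    have "height k w = int k"
      using w assms by (cases n) (simp_all add: ballot_walks_def height_def algebra_simps)
    with w j obtain u v where uv: "w = u @ v" "height k u = j" "positive k v"
      using positive_split_at_height[of k w j] by (auto simp: ballot_walks_def)
    with w assms have "(u, v) \<in> ballot_pairs k n"
      using positive_prefix[of k u v] by (auto simp: ballot_pairs_def ballot_walks_def)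
    with uv show ?thesis by force
  qed
  ultimately show "(\<lambda>(u, v). (u @ v, height k u)) ` ballot_pairs k n =
      ballot_walks k (k * n) (n - 1) \<times> {0..int k}"
    by (auto simp del: height_simps split: prod.splits)
qed

section \<open>The closed formula\<close>

lemma num_minimal_bridges_eq_ballot_walks:
  assumes "0 < k" "0 < n"
  shows "num_minimal_bridges k n = (k + 1) * card (ballot_walks k (k * n) (n - 1))"
proof -
  have "num_minimal_bridges k n = card (ballot_walks k (k * n) (n - 1) \<times> {0..int k})"
    unfolding num_minimal_bridges_def
    using bij_betw_same_card[OF bij_betw_minimal_bridges[OF assms]]
      bij_betw_same_card[OF bij_betw_ballot_walks[OF assms(2), of k]] by simp
  then show ?thesis by (simp add: card_cartesian_product nat_add_distrib)
qed

theorem corollary9: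
  fixes k n :: nat
  assumes "k > 0" and "n > 0"
  shows "real (num_minimal_bridges k n) =
    real k / (real k * real n + real n - 1) * real ((k * n + n) choose n)"
proof -
  obtain m where n: "n = Suc m" using assms(2) by (cases n) auto
  let ?d = "real k * real n + real n - 1"
  let ?B = "card (ballot_walks k (k * n) m)"
  let ?c = "real ((k * n + m) choose m)"
  have "0 < real k * real n" using assms by simp
  then have d: "0 < ?d" unfolding n by simp
  have "real (k * n + m) * real ?B = (real (k * n) - real k * real m) * ?c"
    using assms by (intro ballot) (simp_all add: n)
  \<comment> \<open>Here \<open>?d\<close> is the length \<open>k * n + m\<close> of the ballot
    walks, and the ballot numerator is \<open>k * n - k * m = k\<close>.\<close>
  then have B: "?d * real ?B = real k * ?c"
    by (simp add: n algebra_simps)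
  have "Suc m * ((k * n + n) choose n) = Suc (k * n + m) * ((k * n + m) choose m)"
    using Suc_times_binomial[of m "k * n + m"] by (simp only: n add_Suc_right)
  \<comment> \<open>As \<open>k * n + n\<close> is \<open>n\<close> times \<open>k + 1\<close>,
    cancelling \<open>Suc m\<close> in the absorption identity leaves exactly the factor
    \<open>k + 1\<close> from the bridge count.\<close>
  moreover have "Suc (k * n + m) = Suc m * (k + 1)" by (simp add: n)
  ultimately have "Suc m * ((k * n + n) choose n) = Suc m * ((k + 1) * ((k * n + m) choose m))"
    by (simp only: mult.assoc)
  then have "(k * n + n) choose n = (k + 1) * ((k * n + m) choose m)"
    using mult_cancel1 by blast
  then have C: "real ((k * n + n) choose n) = real (k + 1) * ?c"
    by (simp only: of_nat_mult)
  have "num_minimal_bridges k n = (k + 1) * ?B"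
    using num_minimal_bridges_eq_ballot_walks[OF assms] by (simp only: n diff_Suc_1)
  then have "real (num_minimal_bridges k n) * ?d = real (k + 1) * (?d * real ?B)"
    by (simp only: of_nat_mult mult_ac)
  also have "\<dots> = real k * real ((k * n + n) choose n)"
    unfolding B C by simp
  finally show ?thesis using d by (simp add: field_simps)
qed

end
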